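(* There is no transformation $T$ of a non-atomic standard Borel probability space $(X,\mathcal{F},\mu)$ for which there exists a collection $\{f_i\}_{i\in I}$ of $3$-fold Lebesgue functions for $T$, where $I\subseteq\mathbb{N}=\{1,2,\ldots\}$, such that $L_0^2(\mu)=C(\{f_i\}_{i\in I})$ and, with $$B=\{\widehat{T}^n f_i: i\in I,\ n\in\mathbb{Z}\}\cup\{f_0\},$$ where $f_0$ is a fixed non-zero constant function, one has $$\int_X\varphi\cdot\psi\cdot\overline{\theta}\,d\mu=0$$ for any collection $\varphi,\psi,\theta$ of pairwise different elements of $B$. Here $B$ is regarded as a labelled family: $\widehat{T}^{n_1}f_{i_1}$ and $\widehat{T}^{n_2}f_{i_2}$ are considered different elements of $B$ if and only if $n_1\ne n_2$ or $i_1\neq i_2$ (even if they are equal as elements of $L_0^2(\mu)$).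
   Context: A transformation $T$ is an invertible measure-preserving map of a non-atomic standard Borel probability space $(X,\mathcal{F},\mu)$. $L^2(\mu)$ is the space of complex-valued square-integrable functions. The Koopman operator is the unitary operator $\widehat{T}:L^2(\mu)\to L^2(\mu)$, $\widehat{T}f(x)=f(Tx)$. $L_0^2(\mu)=\{f\in L^2(\mu):\int_X f\,d\mu=0\}$. For a collection of functions $f_i\in L^2(\mu)$, $i\in I$, $C(\{f_i\}_{i\in I})$ denotes the minimal closed $\widehat{T}$-invariant subspace of $L^2(\mu)$ containing all $f_i$, where invariance is under both $\widehat{T}$ and $\widehat{T}^{-1}$; i.e. the closed linear span of $\{\widehat{T}^n f_i: n\in\mathbb{Z},\ i\in I\}$. A non-zero function $f\in L^2(\mu)$ is $3$-fold Lebesgue for $T$ if for any two different non-zero integers $n_1,n_2$: (i) $\widehat{T}^{n_1}f\cdot\widehat{T}^{n_2}f\in L^2(\mu)$; and (ii) $\int_X\widehat{T}^{n_1}f\cdot\widehat{T}^{n_2}f\cdot\overline{f}\,d\mu=0$. (This is the case $k=3$ of the notion of a $k$-fold Lebesgue function.) An equation of the form $\int_X\varphi\cdot\psi\cdot\overline{\theta}\,d\mu=0$ is understood to include the existence of the integral. The constant function $f_0$ counts as an element of $B$ different from all $\widehat{T}^n f_i$, $i\in I$. *)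

theory Defs
  imports "HOL-Probability.Probability"
begin

text \<open>
  A standard Borel space is one whose \<open>\<sigma>\<close>-algebra is generated by some Polish (separable,
  completely metrizable) topology on the underlying set.
\<close>

definition standard_borel_space :: "'a measure \<Rightarrow> bool" where
  "standard_borel_space M \<longleftrightarrow>
     (\<exists>X. topspace X = space M \<and> completely_metrizable_space X \<and> separable_space X \<and>
          sets M = sigma_sets (space M) {U. openin X U})"

definition non_atomic :: "'a measure \<Rightarrow> bool" where
  "non_atomic M \<longleftrightarrow>
     (\<forall>A\<in>sets M. 0 < emeasure M A \<longrightarrow>
        (\<exists>B\<in>sets M. B \<subseteq> A \<and> 0 < emeasure M B \<and> emeasure M B < emeasure M A))"

definition transformation :: "'a measure \<Rightarrow> ('a \<Rightarrow> 'a) \<Rightarrow> bool" where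
  "transformation M T \<longleftrightarrow>
     bij_betw T (space M) (space M) \<and>
     T \<in> measurable M M \<and> the_inv_into (space M) T \<in> measurable M M \<and>
     distr M M T = M"

definition koopman :: "('a \<Rightarrow> 'a) \<Rightarrow> ('a \<Rightarrow> complex) \<Rightarrow> 'a \<Rightarrow> complex" where
  "koopman T f = (\<lambda>x. f (T x))"

text \<open>
  The inverse of the Koopman operator of \<open>T\<close> is the Koopman operator of \<open>T\<^sup>-\<^sup>1\<close>.
\<close>

definition koopman_power ::
    "'a measure \<Rightarrow> ('a \<Rightarrow> 'a) \<Rightarrow> int \<Rightarrow> ('a \<Rightarrow> complex) \<Rightarrow> 'a \<Rightarrow> complex" where
  "koopman_power M T n =
     (if 0 \<le> n then koopman T ^^ nat n
      else koopman (the_inv_into (space M) T) ^^ nat (- n))"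

text \<open>
  Elements of \<open>L\<^sup>2(\<mu>)\<close> are represented by functions rather than by classes modulo null sets.
  Closed subspaces, as defined below, are saturated under almost-everywhere equality, so
  equalities between closed subspaces have their usual meaning.
\<close>

definition L2 :: "'a measure \<Rightarrow> ('a \<Rightarrow> complex) set" where
  "L2 M = {f \<in> borel_measurable M. integrable M (\<lambda>x. (cmod (f x))\<^sup>2)}"

definition L2_norm :: "'a measure \<Rightarrow> ('a \<Rightarrow> complex) \<Rightarrow> real" where
  "L2_norm M f = sqrt (\<integral>x. (cmod (f x))\<^sup>2 \<partial>M)"

definition L2_zero_mean :: "'a measure \<Rightarrow> ('a \<Rightarrow> complex) set" where
  "L2_zero_mean M = {f \<in> L2 M. (\<integral>x. f x \<partial>M) = 0}"

definition closed_L2_subspace :: "'a measure \<Rightarrow> ('a \<Rightarrow> complex) set \<Rightarrow> bool" where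
  "closed_L2_subspace M S \<longleftrightarrow>
     S \<subseteq> L2 M \<and> (\<lambda>_. 0) \<in> S \<and>
     (\<forall>g\<in>S. \<forall>h\<in>S. (\<lambda>x. g x + h x) \<in> S) \<and>
     (\<forall>a. \<forall>g\<in>S. (\<lambda>x. a * g x) \<in> S) \<and>
     (\<forall>g\<in>L2 M. (\<forall>e>0. \<exists>h\<in>S. L2_norm M (\<lambda>x. g x - h x) < e) \<longrightarrow> g \<in> S)"

definition koopman_invariant ::
    "'a measure \<Rightarrow> ('a \<Rightarrow> 'a) \<Rightarrow> ('a \<Rightarrow> complex) set \<Rightarrow> bool" where
  "koopman_invariant M T S \<longleftrightarrow>
     (\<forall>g\<in>S. koopman T g \<in> S \<and> koopman (the_inv_into (space M) T) g \<in> S)"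

definition cyclic_subspace ::
    "'a measure \<Rightarrow> ('a \<Rightarrow> 'a) \<Rightarrow> ('a \<Rightarrow> complex) set \<Rightarrow> ('a \<Rightarrow> complex) set" where
  "cyclic_subspace M T F =
     \<Inter> {S. closed_L2_subspace M S \<and> koopman_invariant M T S \<and> F \<subseteq> S}"

text \<open>
  Here and below, \<^const>\<open>has_bochner_integral\<close> expresses both the existence and the value of the
  integral; \<^const>\<open>lebesgue_integral\<close> alone is \<open>0\<close> for non-integrable functions.
\<close>

definition three_fold_Lebesgue :: "'a measure \<Rightarrow> ('a \<Rightarrow> 'a) \<Rightarrow> ('a \<Rightarrow> complex) \<Rightarrow> bool" where
  "three_fold_Lebesgue M T f \<longleftrightarrow>
     f \<in> L2 M \<and> \<not> (AE x in M. f x = 0) \<and>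
     (\<forall>n1 n2. n1 \<noteq> 0 \<and> n2 \<noteq> 0 \<and> n1 \<noteq> n2 \<longrightarrow>
        (\<lambda>x. koopman_power M T n1 f x * koopman_power M T n2 f x) \<in> L2 M \<and>
        has_bochner_integral M
          (\<lambda>x. koopman_power M T n1 f x * koopman_power M T n2 f x * cnj (f x)) 0)"

text \<open>
  The labelled family \<open>B\<close>: the label \<open>Some (i, n)\<close> stands for the \<open>n\<close>-th Koopman power applied to
  \<open>f i\<close>, and the label \<open>None\<close> for the constant function with value \<open>c\<close>. Elements of the family
  are different if and only if their labels are.
\<close>

definition B_labels :: "nat set \<Rightarrow> (nat \<times> int) option set" where
  "B_labels I = insert None (Some ` (I \<times> UNIV))"

definition B_family ::
    "'a measure \<Rightarrow> ('a \<Rightarrow> 'a) \<Rightarrow> (nat \<Rightarrow> 'a \<Rightarrow> complex) \<Rightarrow> complex \<Rightarrow>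
     (nat \<times> int) option \<Rightarrow> 'a \<Rightarrow> complex" where
  "B_family M T f c l =
     (case l of None \<Rightarrow> (\<lambda>_. c) | Some (i, n) \<Rightarrow> koopman_power M T n (f i))"

end

theory Submission
  imports Defs
begin

text \<open>
  Suppose the family existed. The relations that involve the constant function say that all
  \<open>T\<^sup>n f\<^sub>i\<close> are pairwise orthogonal and that the product of any two of them has integral \<open>0\<close>.
  Since the \<open>T\<^sup>n f\<^sub>i\<close> span the zero-mean functions, a zero-mean function in \<open>L\<^sup>2\<close> is determined by its
  inner products with them (\<open>generators_total\<close>), and one that is orthogonal to all but two of
  them is a combination of these two (\<open>two_term_expansion\<close>).

  Fix one \<open>i\<close> (\<open>I\<close> is non-empty because a non-atomic space carries non-constant functions), let
  \<open>\<phi> = T f\<^sub>i\<close> and \<open>S = T\<^sup>n\<close> with \<open>n \<ge> 1\<close>. The product \<open>\<phi> \<sqdot> (\<phi> \<circ> S)\<close> is in \<open>L\<^sup>2\<close> by the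
  Lebesgue property and is orthogonal to the constants and to every member of the family except
  its two factors. Hence there are constants with
  \<open>\<phi> \<sqdot> (\<phi> \<circ> S) = a \<sqdot> \<phi> + b \<sqdot> (\<phi> \<circ> S)\<close>. In the same way the conjugate of \<open>\<phi>\<close>, which is
  orthogonal to everything except \<open>\<phi>\<close>, is a multiple of \<open>\<phi>\<close>, and this makes \<open>b / a\<close> real
  (\<open>ratio_real_if_cnj_proportional\<close>).

  The equation for the product is rigid, because it is affine in the reciprocal \<open>u = 1 / \<phi>\<close>:
  where \<open>\<phi> \<noteq> 0\<close> it reads \<open>a \<sqdot> (u \<circ> S) + b \<sqdot> u = 1\<close>. If \<open>a\<close> and \<open>b\<close> are
  non-zero, one step of \<open>S\<close> moves the value of \<open>u\<close> by an affine map with slope \<open>- b / a\<close>. A translation,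
  or a slope of absolute value different from \<open>1\<close>, pushes the values, or their distance from
  the fixed point, monotonically in one direction, which a measure-preserving map does not allow unless \<open>u\<close> sits at the fixed point, and
  then \<open>\<phi>\<close> takes a single non-zero value. As the slope is real, only slope \<open>- 1\<close> is left, and then
  \<open>\<phi> \<circ> S\<^sup>2 = \<phi>\<close>, against the orthogonality of \<open>T f\<^sub>i\<close> and \<open>T\<^bsup>2n+1\<^esup> f\<^sub>i\<close>. If just one of \<open>a\<close>, \<open>b\<close> vanishes, \<open>\<phi>\<close> again
  takes a single non-zero value, which its zero mean excludes. What remains is \<open>\<phi> \<sqdot> (\<phi> \<circ> T\<^sup>n) = 0\<close> for all \<open>n \<ge> 1\<close>
  (\<open>product_with_translate_not_in_span\<close>): the points where \<open>\<phi> \<noteq> 0\<close> never return to that set, which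
  Poincare recurrence (\<open>AE_recurrence\<close>) forbids.

  Recurrence and the rigidity of the affine recursion both follow from a single fact
  (\<open>invariant_if_increasing_along_orbits\<close>): a real function that does not decrease along the orbits
  of a measure-preserving map is almost everywhere invariant.
\<close>

section \<open>Measure-preserving maps\<close>

definition measure_preserving :: "'a measure \<Rightarrow> ('a \<Rightarrow> 'a) \<Rightarrow> bool" where
  "measure_preserving M S \<longleftrightarrow> S \<in> measurable M M \<and> distr M M S = M"

lemma measure_preservingD:
  assumes "measure_preserving M S"
  shows "S \<in> measurable M M" "distr M M S = M"
  using assms by (auto simp: measure_preserving_def)

lemma AE_compose_measure_preserving:
  assumes S: "measure_preserving M S" and "AE x in M. P x"
  shows "AE x in M. P (S x)"
proof -
  have "AE x in distr M M S. P x"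
    unfolding measure_preservingD(2)[OF S] by fact
  then show ?thesis
    by (rule AE_distrD[OF measure_preservingD(1)[OF S]])
qed

lemma integrable_compose_measure_preserving:
  fixes f :: "'a \<Rightarrow> 'b::{banach, second_countable_topology}"
  assumes "measure_preserving M S" and "integrable M f"
  shows "integrable M (\<lambda>x. f (S x))"
  using integrable_distr[of S M M f] assms by (simp add: measure_preserving_def)

lemma integral_compose_measure_preserving:
  fixes f :: "'a \<Rightarrow> 'b::{banach, second_countable_topology}"
  assumes "measure_preserving M S" and "f \<in> borel_measurable M"
  shows "(\<integral>x. f (S x) \<partial>M) = (\<integral>x. f x \<partial>M)"
  using integral_distr[of S M M f] assms by (simp add: measure_preserving_def)

lemma measure_preserving_comp:
  assumes "measure_preserving M S" and "measure_preserving M T"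
  shows "measure_preserving M (S \<circ> T)"
  using assms distr_distr[of S M M T M] by (auto simp: measure_preserving_def)

lemma measure_preserving_funpow:
  assumes "measure_preserving M S"
  shows "measure_preserving M (S ^^ n)"
proof (induction n)
  case 0
  show ?case by (simp add: measure_preserving_def id_def distr_id)
next
  case (Suc n)
  from measure_preserving_comp[OF assms this] show ?case by (simp only: funpow.simps)
qed

section \<open>Square-integrable functions\<close>

lemma L2D:
  assumes "f \<in> L2 M"
  shows "f \<in> borel_measurable M" "integrable M (\<lambda>x. (cmod (f x))\<^sup>2)"
  using assms by (auto simp: L2_def)

lemma L2_add:
  assumes "f \<in> L2 M" "g \<in> L2 M"
  shows "(\<lambda>x. f x + g x) \<in> L2 M"
proof -
  note [measurable] = L2D(1)[OF assms(1)] L2D(1)[OF assms(2)]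
  have le: "(cmod (u + v))\<^sup>2 \<le> 2 * (cmod u)\<^sup>2 + 2 * (cmod v)\<^sup>2" for u v
  proof -
    have "(cmod (u + v))\<^sup>2 \<le> (cmod u + cmod v)\<^sup>2"
      by (intro power_mono norm_triangle_ineq norm_ge_zero)
    also have "\<dots> \<le> 2 * (cmod u)\<^sup>2 + 2 * (cmod v)\<^sup>2"
      using sum_squares_bound[of "cmod u" "cmod v"] by (simp add: power2_sum)
    finally show ?thesis .
  qed
  have "integrable M (\<lambda>x. (cmod (f x + g x))\<^sup>2)"
    by (rule Bochner_Integration.integrable_bound[of M
          "\<lambda>x. 2 * (cmod (f x))\<^sup>2 + 2 * (cmod (g x))\<^sup>2"])
      (use L2D(2)[OF assms(1)] L2D(2)[OF assms(2)] le in auto)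
  then show ?thesis by (simp add: L2_def)
qed

lemma L2_scale:
  assumes "f \<in> L2 M"
  shows "(\<lambda>x. a * f x) \<in> L2 M"
  using L2D[OF assms] by (simp add: L2_def norm_mult power_mult_distrib)

lemma L2_diff:
  assumes "f \<in> L2 M" "g \<in> L2 M"
  shows "(\<lambda>x. f x - g x) \<in> L2 M"
  using L2_add[OF assms(1) L2_scale[OF assms(2), of "- 1"]] by simp

lemma borel_measurable_cnj [measurable]:
  "f \<in> borel_measurable M \<Longrightarrow> (\<lambda>x. cnj (f x)) \<in> borel_measurable M"
  by (rule borel_measurable_continuous_on[OF continuous_on_cnj[OF continuous_on_id]])

lemma L2_cnj:
  assumes "f \<in> L2 M"
  shows "(\<lambda>x. cnj (f x)) \<in> L2 M"
  using L2D[OF assms] by (simp add: L2_def)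

lemma L2_compose:
  assumes "measure_preserving M S" "f \<in> L2 M"
  shows "(\<lambda>x. f (S x)) \<in> L2 M"
  using L2D[OF assms(2)] measure_preservingD(1)[OF assms(1)]
    integrable_compose_measure_preserving[OF assms(1), of "\<lambda>x. (cmod (f x))\<^sup>2"]
  by (auto simp: L2_def)

lemma L2_mult_cnj_integrable:
  assumes "f \<in> L2 M" "g \<in> L2 M"
  shows "integrable M (\<lambda>x. f x * cnj (g x))"
proof -
  note [measurable] = L2D(1)[OF assms(1)] L2D(1)[OF assms(2)]
  have le: "cmod u * cmod v \<le> (cmod u)\<^sup>2 + (cmod v)\<^sup>2" for u v
    using sum_squares_bound[of "cmod u" "cmod v"]
      mult_nonneg_nonneg[OF norm_ge_zero[of u] norm_ge_zero[of v]] by linarith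
  show ?thesis
    by (rule Bochner_Integration.integrable_bound[of M
          "\<lambda>x. (cmod (f x))\<^sup>2 + (cmod (g x))\<^sup>2"])
      (use L2D(2)[OF assms(1)] L2D(2)[OF assms(2)] le in \<open>auto simp: norm_mult\<close>)
qed

lemma L2_integrable:
  assumes "prob_space M" "f \<in> L2 M"
  shows "integrable M f"
proof -
  interpret prob_space M by fact
  have "(\<lambda>_. 1) \<in> L2 M" by (simp add: L2_def)
  from L2_mult_cnj_integrable[OF assms(2) this] show ?thesis by simp
qed

text \<open>
  A substitute for the Cauchy--Schwarz inequality that still gives the continuity of the inner
  product in its first argument: integrate \<open>\<bar>d g\<bar> \<le> \<bar>d\<bar>\<^sup>2 / e + e \<bar>g\<bar>\<^sup>2\<close>.
\<close>

lemma L2_inner_small: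
  assumes d: "d \<in> L2 M" and g: "g \<in> L2 M" and "L2_norm M d < e"
  shows "cmod (\<integral>x. d x * cnj (g x) \<partial>M) \<le> e * (1 + (L2_norm M g)\<^sup>2)"
proof -
  have sq: "(L2_norm M h)\<^sup>2 = (\<integral>x. (cmod (h x))\<^sup>2 \<partial>M)" for h
    by (simp add: L2_norm_def)
  have nonneg: "0 \<le> L2_norm M d" by (simp add: L2_norm_def)
  with assms have e: "0 < e" by simp
  have le: "cmod (u * cnj v) \<le> (cmod u)\<^sup>2 / e + e * (cmod v)\<^sup>2" for u v
  proof -
    have "e * (cmod u * cmod v) \<le> (cmod u - e * cmod v)\<^sup>2 + 2 * (e * (cmod u * cmod v))"
      using e by simp
    also have "\<dots> = e * ((cmod u)\<^sup>2 / e + e * (cmod v)\<^sup>2)"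
      using e by (simp add: power2_diff power_mult_distrib distrib_left power2_eq_square[of e])
    finally show ?thesis
      using e by (simp add: norm_mult)
  qed
  note int = L2D(2)[OF d] L2D(2)[OF g]
  have "cmod (\<integral>x. d x * cnj (g x) \<partial>M) \<le> (\<integral>x. (cmod (d x))\<^sup>2 / e + e * (cmod (g x))\<^sup>2 \<partial>M)"
    by (rule order_trans[OF integral_norm_bound integral_mono])
      (use int L2_mult_cnj_integrable[OF d g] le in auto)
  also have "\<dots> = (L2_norm M d)\<^sup>2 / e + e * (L2_norm M g)\<^sup>2"
    unfolding sq using int by simp
  also have "(L2_norm M d)\<^sup>2 / e \<le> e"
    using nonneg assms(3) e power_mono[of "L2_norm M d" e 2]
    by (simp add: pos_divide_le_eq power2_eq_square)
  finally show ?thesis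
    by (simp add: distrib_left)
qed

lemma AE_zero_if_inner_self_zero:
  assumes "g \<in> L2 M" and "(\<integral>x. g x * cnj (g x) \<partial>M) = 0"
  shows "AE x in M. g x = 0"
proof -
  have "(\<integral>x. complex_of_real ((cmod (g x))\<^sup>2) \<partial>M) = 0"
    using assms(2) by (simp only: complex_norm_square)
  then have "(\<integral>x. (cmod (g x))\<^sup>2 \<partial>M) = 0"
    by (simp only: integral_complex_of_real of_real_eq_0_iff)
  then show ?thesis
    using L2D(2)[OF assms(1)] by (subst (asm) integral_nonneg_eq_0_iff_AE) auto
qed

section \<open>Rigidity of measure-preserving dynamics\<close>

text \<open>
  The functions \<open>v \<circ> S\<close> and \<open>v\<close> have the same distribution, so the non-negative function
  \<open>arctan \<circ> v \<circ> S - arctan \<circ> v\<close> has integral \<open>0\<close>. Only the boundedness and the strict monotonicity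
  of \<open>arctan\<close> matter; they make the integrals exist for every measurable \<open>v\<close>.
\<close>

lemma invariant_if_increasing_along_orbits:
  fixes v :: "'a \<Rightarrow> real"
  assumes M: "prob_space M" and S: "measure_preserving M S"
    and v[measurable]: "v \<in> borel_measurable M"
    and le: "AE x in M. v x \<le> v (S x)"
  shows "AE x in M. v (S x) = v x"
proof -
  interpret prob_space M by fact
  note [measurable] = measure_preservingD(1)[OF S]
  have bdd: "\<bar>arctan t\<bar> \<le> pi / 2" for t
    using arctan_bounded[of t] by auto
  have int: "integrable M (\<lambda>x. arctan (v x))"
    by (rule integrable_const_bound[where B = "pi / 2"]) (use bdd in auto)
  have int': "integrable M (\<lambda>x. arctan (v (S x)))"
    by (rule integrable_compose_measure_preserving[OF S int])
  have "(\<integral>x. arctan (v (S x)) - arctan (v x) \<partial>M) = 0"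
    using int int' integral_compose_measure_preserving[OF S, of "\<lambda>x. arctan (v x)"] by simp
  moreover have "AE x in M. 0 \<le> arctan (v (S x)) - arctan (v x)"
    using le by eventually_elim (simp add: arctan_le_iff)
  ultimately have "AE x in M. arctan (v (S x)) - arctan (v x) = 0"
    using integral_nonneg_eq_0_iff_AE[OF Bochner_Integration.integrable_diff[OF int' int]]
    by simp
  then show ?thesis
    by eventually_elim (simp add: arctan_eq_iff)
qed

text \<open>
  Poincare recurrence. The set of points whose orbit, time \<open>0\<close> included, meets \<open>P\<close> can only be left
  along an orbit, never entered. By the previous lemma it agrees with its preimage up to a null
  set, and this preimage consists of the points that meet \<open>P\<close> at a positive time.
\<close>

lemma AE_recurrence:
  assumes M: "prob_space M" and S: "measure_preserving M S"
    and [measurable]: "Measurable.pred M P"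
  shows "AE x in M. P x \<longrightarrow> (\<exists>n\<ge>1. P ((S ^^ n) x))"
proof -
  have [measurable]: "(S ^^ n) \<in> measurable M M" for n
    by (rule measure_preservingD(1)[OF measure_preserving_funpow[OF S]])
  define v :: "_ \<Rightarrow> real" where "v x = - of_bool (\<exists>n. P ((S ^^ n) x))" for x
  have [measurable]: "v \<in> borel_measurable M"
    unfolding v_def of_bool_def by measurable
  have shift: "(S ^^ n) (S x) = (S ^^ Suc n) x" for n x
    by (simp add: funpow_Suc_right del: funpow.simps)
  have "v x \<le> v (S x)" for x
    unfolding v_def shift by (auto simp: of_bool_def simp del: funpow.simps)
  then have "AE x in M. v (S x) = v x"
    by (intro invariant_if_increasing_along_orbits[OF M S]) auto
  then show ?thesis
  proof eventually_elim
    case (elim x)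
    show ?case
    proof
      assume "P x"
      then have "\<exists>n. P ((S ^^ n) x)"
        by (intro exI[of _ 0]) simp
      then have "\<exists>n. P ((S ^^ Suc n) x)"
        using elim unfolding v_def shift by (auto simp: of_bool_def split: if_splits)
      then show "\<exists>n\<ge>1. P ((S ^^ n) x)"
        by (metis le_add1 plus_1_eq_Suc)
    qed
  qed
qed

text \<open>
  Such an \<open>f\<close> is \<open>k\<close> times the indicator of its support, so for \<open>k \<noteq> 0\<close> a zero mean forces the
  support to be a null set.
\<close>

lemma AE_zero_if_two_valued:
  fixes f :: "'a \<Rightarrow> complex"
  assumes M: "prob_space M" and [measurable]: "f \<in> borel_measurable M"
    and mean: "(\<integral>x. f x \<partial>M) = 0" and two: "AE x in M. f x = 0 \<or> f x = k"
  shows "AE x in M. f x = 0"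
proof (cases "k = 0")
  case True
  with two show ?thesis by auto
next
  case False
  interpret prob_space M by fact
  have int: "integrable M (\<lambda>x. of_bool (f x \<noteq> 0) :: real)"
    by (rule integrable_const_bound[where B = 1]) (auto simp: of_bool_def)
  have "(\<integral>x. f x \<partial>M) = (\<integral>x. k * complex_of_real (of_bool (f x \<noteq> 0)) \<partial>M)"
    using two by (intro integral_cong_AE) (auto simp: of_bool_def)
  also have "\<dots> = k * complex_of_real (\<integral>x. of_bool (f x \<noteq> 0) \<partial>M)"
    by (simp only: integral_mult_right_zero integral_complex_of_real)
  finally have "(\<integral>x. of_bool (f x \<noteq> 0) \<partial>M) = (0::real)"
    using False mean by simp
  then have "AE x in M. of_bool (f x \<noteq> 0) = (0::real)"
    using int by (subst (asm) integral_nonneg_eq_0_iff_AE) auto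
  then show ?thesis by auto
qed

text \<open>
  Because \<open>\<bar>a\<bar>\<close> and \<open>\<bar>b\<bar>\<close> differ, \<open>\<bar>w\<bar>\<close> is monotone along orbits, hence invariant; the equation then
  compares two different multiples of \<open>\<bar>w\<bar>\<close>.
\<close>

lemma AE_zero_if_eigenfunction:
  fixes w :: "'a \<Rightarrow> complex"
  assumes M: "prob_space M" and S: "measure_preserving M S"
    and w[measurable]: "w \<in> borel_measurable M"
    and eq: "AE x in M. a * w (S x) = b * w x" and "cmod a \<noteq> cmod b"
  shows "AE x in M. w x = 0"
proof -
  from eq have eq': "AE x in M. cmod a * cmod (w (S x)) = cmod b * cmod (w x)"
    by eventually_elim (metis norm_mult)
  have "AE x in M. cmod (w (S x)) = cmod (w x)"
  proof (cases "cmod a < cmod b")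
    case True
    from eq' have "AE x in M. cmod (w x) \<le> cmod (w (S x))"
    proof eventually_elim
      case (elim x)
      then have "cmod b * cmod (w x) \<le> cmod b * cmod (w (S x))"
        using True by (metis less_eq_real_def mult_right_mono norm_ge_zero)
      then show ?case
        using True by (smt (verit) mult_le_cancel_left_pos norm_ge_zero)
    qed
    then show ?thesis
      by (intro invariant_if_increasing_along_orbits[OF M S]) auto
  next
    case False
    with \<open>cmod a \<noteq> cmod b\<close> have less: "cmod b < cmod a" by simp
    from eq' have "AE x in M. - cmod (w x) \<le> - cmod (w (S x))"
    proof eventually_elim
      case (elim x)
      then have "cmod a * cmod (w (S x)) \<le> cmod a * cmod (w x)"
        using less by (metis less_eq_real_def mult_right_mono norm_ge_zero)
      then show ?case
        using less by (smt (verit) mult_le_cancel_left_pos norm_ge_zero)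
    qed
    then have "AE x in M. - cmod (w (S x)) = - cmod (w x)"
      by (intro invariant_if_increasing_along_orbits[OF M S]) auto
    then show ?thesis by auto
  qed
  with eq' show ?thesis
    by eventually_elim (use \<open>cmod a \<noteq> cmod b\<close> in auto)
qed

lemma real_ratio_same_norm:
  fixes a b :: complex
  assumes "b * cnj a = cnj b * a" and "cmod a = cmod b"
  shows "b = a \<or> b = - a"
proof -
  have n: "a * cnj a = b * cnj b"
    using assms(2) by (simp add: complex_norm_square[symmetric])
  show ?thesis
  proof (cases "a = 0")
    case False
    have "(b * b - a * a) * cnj a = b * (b * cnj a) - a * (a * cnj a)"
      by (simp add: algebra_simps)
    also have "\<dots> = 0"
      unfolding assms(1) n by (simp add: algebra_simps)
    finally have "(b - a) * (b + a) = 0"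
      using False by (simp add: algebra_simps)
    then show ?thesis
      by (simp add: eq_neg_iff_add_eq_0)
  qed (use assms(2) in auto)
qed

text \<open>
  The core of the argument. For non-zero \<open>a\<close> and \<open>b\<close> the case distinction follows the map that sends the value of \<open>1 / f\<close>
  at \<open>x\<close> to its value at \<open>S x\<close>: it is a translation if \<open>a + b = 0\<close>, otherwise it has the fixed
  point \<open>k = 1 / (a + b)\<close> and multiplies the distance from \<open>k\<close> by \<open>\<bar>b\<bar> / \<bar>a\<bar>\<close>. The realness of
  \<open>b / a\<close> excludes rotations about \<open>k\<close> other than the half-turn. In every case except
  \<open>a = b = 0\<close> the function \<open>f\<close> itself vanishes.
\<close>

lemma product_with_translate_not_in_span:
  fixes f :: "'a \<Rightarrow> complex"
  assumes M: "prob_space M" and S: "measure_preserving M S" and f: "f \<in> L2 M"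
    and mean: "(\<integral>x. f x \<partial>M) = 0"
    and orth: "(\<integral>x. f (S (S x)) * cnj (f x) \<partial>M) = 0"
    and real: "b * cnj a = cnj b * a"
    and eq: "AE x in M. f x * f (S x) = a * f x + b * f (S x)"
  shows "AE x in M. f x * f (S x) = 0"
proof -
  interpret prob_space M by fact
  have f_meas[measurable]: "f \<in> borel_measurable M"
    and f_sq: "integrable M (\<lambda>x. (cmod (f x))\<^sup>2)"
    using f by (auto simp: L2_def)
  note S_meas[measurable] = measure_preservingD(1)[OF S]
  consider "a = 0" "b = 0" | "a \<noteq> 0" "b = 0" | "a = 0" "b \<noteq> 0" | "a \<noteq> 0" "b \<noteq> 0"
    by auto
  then show ?thesis
  proof cases
    case 1
    with eq show ?thesis by simp
  next
    case 2
    \<comment> \<open>The support of \<open>f\<close> lies in \<open>{x. f (S x) = a}\<close>, hence in its own preimage under \<open>S\<close>, so all three sets agree up to null sets.\<close>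
    from eq have "AE x in M. of_bool (f x \<noteq> 0) \<le> (of_bool (f (S x) \<noteq> 0) :: real)"
      by eventually_elim (use 2 in auto)
    then have "AE x in M. of_bool (f (S x) \<noteq> 0) = (of_bool (f x \<noteq> 0) :: real)"
      by (intro invariant_if_increasing_along_orbits[OF M S]) auto
    with eq have "AE x in M. f (S x) = 0 \<or> f (S x) = a"
      by eventually_elim (use 2 in \<open>auto simp: of_bool_def split: if_splits\<close>)
    moreover have "(\<integral>x. f (S x) \<partial>M) = 0"
      using integral_compose_measure_preserving[OF S f_meas] mean by simp
    ultimately have "AE x in M. f (S x) = 0"
      by (intro AE_zero_if_two_valued[OF M]) auto
    then show ?thesis by auto
  next
    case 3
    \<comment> \<open>Here \<open>f (S x) \<noteq> 0\<close> forces \<open>f x = b\<close>: the support contains its preimage.\<close>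
    from eq have "AE x in M. - of_bool (f x \<noteq> 0) \<le> (- of_bool (f (S x) \<noteq> 0) :: real)"
      by eventually_elim (use 3 in auto)
    then have "AE x in M. - of_bool (f (S x) \<noteq> 0) = (- of_bool (f x \<noteq> 0) :: real)"
      by (intro invariant_if_increasing_along_orbits[OF M S]) auto
    with eq have "AE x in M. f x = 0 \<or> f x = b"
      by eventually_elim (use 3 in \<open>auto simp: of_bool_def split: if_splits\<close>)
    then have "AE x in M. f x = 0"
      by (intro AE_zero_if_two_valued[OF M _ mean]) auto
    then show ?thesis by auto
  next
    case 4
    from eq have supp: "AE x in M. f (S x) = 0 \<longleftrightarrow> f x = 0"
      by eventually_elim (use 4 in auto)
    from eq supp have recip:
      "AE x in M. f x \<noteq> 0 \<longrightarrow> a * inverse (f (S x)) + b * inverse (f x) = 1"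
      by eventually_elim (auto simp: field_simps)
    have "AE x in M. f x = 0"
    proof (cases "a + b = 0")
      case True
      \<comment> \<open>Off the support the convention \<open>inverse 0 = 0\<close> gives \<open>v = 0\<close>; on it \<open>v\<close> grows by \<open>1\<close> at each step.\<close>
      define v where "v x = Re (a * inverse (f x))" for x
      have [measurable]: "v \<in> borel_measurable M"
        unfolding v_def by measurable
      have b: "b = - a"
        using True by (simp add: add_eq_0_iff)
      from recip supp have v: "AE x in M. v (S x) = v x + of_bool (f x \<noteq> 0)"
      proof eventually_elim
        case (elim x)
        show ?case
        proof (cases "f x = 0")
          case False
          with elim b have "a * inverse (f (S x)) = a * inverse (f x) + 1"
            by (simp add: algebra_simps)
          with False show ?thesis by (simp add: v_def)
        qed (use elim in \<open>simp add: v_def\<close>)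
      qed
      then have "AE x in M. v x \<le> v (S x)"
        by eventually_elim simp
      then have "AE x in M. v (S x) = v x"
        by (intro invariant_if_increasing_along_orbits[OF M S]) auto
      with v show ?thesis
        by eventually_elim auto
    next
      case False
      define k where "k = inverse (a + b)"
      define w where "w x = (if f x = 0 then 0 else inverse (f x) - k)" for x
      have [measurable]: "w \<in> borel_measurable M"
        unfolding w_def by measurable
      have k: "a * k + b * k = 1"
        using False by (simp add: k_def flip: distrib_right)
      from recip supp have w: "AE x in M. a * w (S x) = (- b) * w x"
      proof eventually_elim
        case (elim x)
        show ?case
        proof (cases "f x = 0")
          case False
          with elim have "a * inverse (f (S x)) + b * inverse (f x) = a * k + b * k"
            using k by simp
          then have "a * (inverse (f (S x)) - k) + b * (inverse (f x) - k) = 0"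
            by (simp add: algebra_simps)
          with False elim show ?thesis
            by (simp add: w_def add_eq_0_iff2)
        qed (use elim in \<open>simp add: w_def\<close>)
      qed
      show ?thesis
      proof (cases "cmod a = cmod (- b)")
        case False
        from AE_zero_if_eigenfunction[OF M S _ w False]
        have "AE x in M. w x = 0" by simp
        then have "AE x in M. f x = 0 \<or> f x = inverse k"
          by eventually_elim (auto simp: w_def split: if_splits)
        then show ?thesis
          by (intro AE_zero_if_two_valued[OF M _ mean]) auto
      next
        case True
        \<comment> \<open>The map is the half-turn about \<open>k\<close>: two steps return \<open>w\<close>, and with it \<open>f\<close>, to its old value.\<close>
        then have "b = a"
          using real_ratio_same_norm[OF real] False \<open>a + b \<noteq> 0\<close> by auto
        from w have w1: "AE x in M. w (S x) = - w x"
        proof eventually_elim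
          case (elim x)
          with \<open>b = a\<close> have "a * w (S x) = a * (- w x)" by simp
          with 4 show ?case by (metis mult_left_cancel)
        qed
        from AE_compose_measure_preserving[OF S w1] w1
          AE_compose_measure_preserving[OF S supp] supp
        have "AE x in M. f (S (S x)) = f x"
          by eventually_elim (auto simp: w_def split: if_splits)
        then have "AE x in M. f (S (S x)) * cnj (f x) = f x * cnj (f x)"
          by eventually_elim simp
        moreover have "(\<lambda>x. f (S (S x)) * cnj (f x)) \<in> borel_measurable M"
          by measurable
        moreover have "(\<lambda>x. f x * cnj (f x)) \<in> borel_measurable M"
          by measurable
        ultimately have "(\<integral>x. f x * cnj (f x) \<partial>M) = 0"
          using orth integral_cong_AE[of "\<lambda>x. f (S (S x)) * cnj (f x)" M "\<lambda>x. f x * cnj (f x)"]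
          by simp
        then show ?thesis
          by (rule AE_zero_if_inner_self_zero[OF f])
      qed
    qed
    then show ?thesis by auto
  qed
qed

section \<open>Orthogonal families of Koopman translates\<close>

text \<open>
  The integer power \<open>T\<^sup>n\<close> on the space of \<open>M\<close>; every Koopman power is composition with it.
\<close>

definition orbit_map :: "'a measure \<Rightarrow> ('a \<Rightarrow> 'a) \<Rightarrow> int \<Rightarrow> 'a \<Rightarrow> 'a" where
  "orbit_map M T n =
     (if 0 \<le> n then T ^^ nat n else the_inv_into (space M) T ^^ nat (- n))"

lemma koopman_funpow: "(koopman T ^^ n) f x = f ((T ^^ n) x)"
proof (induction n arbitrary: x)
  case (Suc n)
  have "(koopman T ^^ Suc n) f x = (koopman T ^^ n) f (T x)"
    by (simp add: koopman_def)
  with Suc show ?case by (simp add: funpow_swap1)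
qed simp

lemma koopman_power_eq_compose: "koopman_power M T n f = (\<lambda>x. f (orbit_map M T n x))"
  by (auto simp: koopman_power_def orbit_map_def koopman_funpow)

lemma transformation_measure_preserving:
  assumes "transformation M T"
  shows "measure_preserving M T" and "measure_preserving M (the_inv_into (space M) T)"
proof -
  let ?R = "the_inv_into (space M) T"
  have T: "T \<in> measurable M M" "?R \<in> measurable M M" "distr M M T = M"
    and inj: "inj_on T (space M)"
    using assms by (auto simp: transformation_def bij_betw_def)
  show "measure_preserving M T"
    using T by (simp add: measure_preserving_def)
  have "distr M M ?R = distr (distr M M T) M ?R"
    by (simp only: T(3))
  also have "\<dots> = distr M M (?R \<circ> T)"
    by (rule distr_distr) (use T in auto)
  also have "\<dots> = distr M M (\<lambda>x. x)"
    by (rule distr_cong) (auto simp: the_inv_into_f_f[OF inj])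
  finally show "measure_preserving M ?R"
    using T by (simp add: measure_preserving_def)
qed

lemma measure_preserving_orbit_map:
  assumes "transformation M T"
  shows "measure_preserving M (orbit_map M T n)"
  using transformation_measure_preserving[OF assms]
  by (simp add: orbit_map_def measure_preserving_funpow)

lemma orbit_map_step:
  assumes T: "transformation M T" and x: "x \<in> space M"
  shows "T (orbit_map M T n x) = orbit_map M T (n + 1) x"
    and "the_inv_into (space M) T (orbit_map M T n x) = orbit_map M T (n - 1) x"
proof -
  let ?R = "the_inv_into (space M) T"
  have bij: "bij_betw T (space M) (space M)"
    using T by (simp add: transformation_def)
  have TR: "T (?R y) = y" and RT: "?R (T y) = y" if "y \<in> space M" for y
    using bij that by (auto simp: bij_betw_def f_the_inv_into_f the_inv_into_f_f)
  have pos: "(T ^^ k) x \<in> space M" and neg: "(?R ^^ k) x \<in> space M" for k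
    using transformation_measure_preserving[OF T] x
    by (meson measurable_space measure_preservingD(1) measure_preserving_funpow)+
  show "T (orbit_map M T n x) = orbit_map M T (n + 1) x"
  proof (cases "0 \<le> n")
    case True
    then have "nat (n + 1) = Suc (nat n)" by simp
    with True show ?thesis by (simp add: orbit_map_def)
  next
    case False
    then have "nat (- n) = Suc (nat (- (n + 1)))" by simp
    with False show ?thesis
      by (cases "n = - 1") (auto simp: orbit_map_def TR neg x)
  qed
  show "?R (orbit_map M T n x) = orbit_map M T (n - 1) x"
  proof (cases "0 < n")
    case True
    then have "nat n = Suc (nat (n - 1))" by simp
    with True show ?thesis by (simp add: orbit_map_def RT pos)
  next
    case False
    then have "nat (- (n - 1)) = Suc (nat (- n))" by simp
    with False show ?thesis
      by (cases "n = 0") (auto simp: orbit_map_def)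
  qed
qed

text \<open>
  With \<open>R\<close> the powers of a transformation, this is the space of functions all of whose translates
  are orthogonal to \<open>g\<close>. It is also Koopman-invariant, which allows the minimality of the cyclic
  subspace to be used.
\<close>

lemma closed_L2_subspace_orthogonal:
  assumes g: "g \<in> L2 M" and R: "\<And>n. measure_preserving M (R n)"
  shows "closed_L2_subspace M {h \<in> L2 M. \<forall>n. (\<integral>x. h (R n x) * cnj (g x) \<partial>M) = 0}"
    (is "closed_L2_subspace M ?S")
proof -
  have int: "integrable M (\<lambda>x. h (R n x) * cnj (g x))" if "h \<in> L2 M" for h n
    by (rule L2_mult_cnj_integrable[OF L2_compose[OF R that] g])
  have "h \<in> ?S"
    if h: "h \<in> L2 M" and approx: "\<forall>e>0. \<exists>k\<in>?S. L2_norm M (\<lambda>x. h x - k x) < e" for h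
  proof -
    have "(\<integral>x. h (R n x) * cnj (g x) \<partial>M) = 0" for n
    proof -
      let ?I = "\<integral>x. h (R n x) * cnj (g x) \<partial>M" and ?G = "1 + (L2_norm M g)\<^sup>2"
      have bound: "cmod ?I \<le> e * ?G" if "0 < e" for e
      proof -
        from approx that obtain k where k: "k \<in> ?S" and e: "L2_norm M (\<lambda>x. h x - k x) < e"
          by blast
        let ?d = "\<lambda>x. h x - k x"
        have d: "?d \<in> L2 M"
          using h k by (intro L2_diff) auto
        have "L2_norm M (\<lambda>x. ?d (R n x)) = L2_norm M ?d"
          unfolding L2_norm_def
          using integral_compose_measure_preserving[OF R, of "\<lambda>x. (cmod (?d x))\<^sup>2" n] L2D[OF d]
          by simp
        with e L2_inner_small[OF L2_compose[OF R d] g]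
        have "cmod (\<integral>x. ?d (R n x) * cnj (g x) \<partial>M) \<le> e * ?G"
          by simp
        also have "(\<integral>x. ?d (R n x) * cnj (g x) \<partial>M) = ?I"
          using k int[OF h, of n] int[of k n] by (simp add: left_diff_distrib)
        finally show ?thesis .
      qed
      have "0 < ?G"
        by (simp add: add_pos_nonneg)
      then have "cmod ?I \<le> 0 + e" if "0 < e" for e
        using bound[of "e / ?G"] that by simp
      then have "cmod ?I \<le> 0"
        by (rule field_le_epsilon)
      then show ?thesis by simp
    qed
    with h show ?thesis by simp
  qed
  moreover have "(\<lambda>_. 0) \<in> ?S"
    by (simp add: L2_def)
  moreover have "(\<lambda>x. h x + k x) \<in> ?S" if "h \<in> ?S" "k \<in> ?S" for h k
    using that L2_add[of h M k] int[of h] int[of k] by (simp add: distrib_right)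
  moreover have "(\<lambda>x. a * h x) \<in> ?S" if "h \<in> ?S" for a h
    using that L2_scale[of h M a] by (simp add: mult.assoc)
  ultimately show ?thesis
    unfolding closed_L2_subspace_def by (intro conjI ballI allI impI) auto
qed

text \<open>
  The functions whose translates are all orthogonal to \<open>g\<close> form a closed invariant subspace that
  contains the generators, hence all zero-mean functions, hence \<open>g\<close>.
\<close>

lemma generators_total:
  assumes T: "transformation M T" and gen: "L2_zero_mean M = cyclic_subspace M T F"
    and g: "g \<in> L2 M" and mean: "(\<integral>x. g x \<partial>M) = 0"
    and orth: "\<And>f n. f \<in> F \<Longrightarrow> (\<integral>x. koopman_power M T n f x * cnj (g x) \<partial>M) = 0"
  shows "AE x in M. g x = 0"
proof -
  let ?R = "orbit_map M T"
  let ?S = "{h \<in> L2 M. \<forall>n. (\<integral>x. h (?R n x) * cnj (g x) \<partial>M) = 0}"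
  have F: "F \<subseteq> L2 M"
    using gen by (auto simp: cyclic_subspace_def L2_zero_mean_def)
  have closed: "closed_L2_subspace M ?S"
    by (intro closed_L2_subspace_orthogonal g measure_preserving_orbit_map T)
  have "koopman T h \<in> ?S \<and> koopman (the_inv_into (space M) T) h \<in> ?S" if h: "h \<in> ?S" for h
  proof
    have "(\<integral>x. h (T (?R n x)) * cnj (g x) \<partial>M) = (\<integral>x. h (?R (n + 1) x) * cnj (g x) \<partial>M)"
      and "(\<integral>x. h (the_inv_into (space M) T (?R n x)) * cnj (g x) \<partial>M)
        = (\<integral>x. h (?R (n - 1) x) * cnj (g x) \<partial>M)" for n
      by (intro Bochner_Integration.integral_cong; simp add: orbit_map_step[OF T])+
    with h L2_compose[OF transformation_measure_preserving(1)[OF T], of h]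
      L2_compose[OF transformation_measure_preserving(2)[OF T], of h]
    show "koopman T h \<in> ?S" "koopman (the_inv_into (space M) T) h \<in> ?S"
      by (auto simp: koopman_def)
  qed
  then have "koopman_invariant M T ?S"
    unfolding koopman_invariant_def by blast
  moreover have "F \<subseteq> ?S"
    using F orth by (auto simp: koopman_power_eq_compose)
  ultimately have "L2_zero_mean M \<subseteq> ?S"
    using closed unfolding gen cyclic_subspace_def by blast
  with g mean have "(\<integral>x. g (?R 0 x) * cnj (g x) \<partial>M) = 0"
    by (auto simp: L2_zero_mean_def)
  with g show ?thesis
    by (intro AE_zero_if_inner_self_zero) (auto simp: orbit_map_def)
qed

text \<open>
  The remainder \<open>h - (a \<sqdot> e\<^sub>p + b \<sqdot> e\<^sub>q)\<close> has zero mean and is orthogonal to the whole family,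
  so totality makes it vanish.
\<close>

lemma two_term_expansion:
  fixes e :: "'l \<Rightarrow> 'a \<Rightarrow> complex"
  assumes e: "\<And>l. l \<in> E \<Longrightarrow> e l \<in> L2 M" and M: "prob_space M"
    and mean: "\<And>l. l \<in> E \<Longrightarrow> (\<integral>x. e l x \<partial>M) = 0"
    and orth: "\<And>l m. \<lbrakk>l \<in> E; m \<in> E; l \<noteq> m\<rbrakk> \<Longrightarrow> (\<integral>x. e l x * cnj (e m x) \<partial>M) = 0"
    and total: "\<And>g. \<lbrakk>g \<in> L2 M; (\<integral>x. g x \<partial>M) = 0; \<And>l. l \<in> E \<Longrightarrow> (\<integral>x. e l x * cnj (g x) \<partial>M) = 0\<rbrakk>
       \<Longrightarrow> AE x in M. g x = 0"
    and pq: "p \<in> E" "q \<in> E" "p \<noteq> q"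
    and a: "(\<integral>x. h x * cnj (e p x) \<partial>M) = a * (\<integral>x. e p x * cnj (e p x) \<partial>M)"
    and b: "(\<integral>x. h x * cnj (e q x) \<partial>M) = b * (\<integral>x. e q x * cnj (e q x) \<partial>M)"
    and h: "h \<in> L2 M" "(\<integral>x. h x \<partial>M) = 0"
    and h_orth: "\<And>l. \<lbrakk>l \<in> E; l \<noteq> p; l \<noteq> q\<rbrakk> \<Longrightarrow> (\<integral>x. h x * cnj (e l x) \<partial>M) = 0"
  shows "AE x in M. h x = a * e p x + b * e q x"
proof -
  define g where "g x = h x - (a * e p x + b * e q x)" for x
  have g: "g \<in> L2 M"
    unfolding g_def using h e pq by (intro L2_diff L2_add L2_scale) auto
  have "(\<integral>x. g x \<partial>M) = 0"
    unfolding g_def using h mean pq e L2_integrable[OF M] by simp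
  moreover have "(\<integral>x. e l x * cnj (g x) \<partial>M) = 0" if l: "l \<in> E" for l
  proof -
    have "(\<integral>x. g x * cnj (e l x) \<partial>M) = (\<integral>x. h x * cnj (e l x) \<partial>M)
        - (a * (\<integral>x. e p x * cnj (e l x) \<partial>M) + b * (\<integral>x. e q x * cnj (e l x) \<partial>M))"
      unfolding g_def
      using L2_mult_cnj_integrable[OF h(1) e[OF l]] L2_mult_cnj_integrable[OF e[OF pq(1)] e[OF l]]
        L2_mult_cnj_integrable[OF e[OF pq(2)] e[OF l]]
      by (simp add: left_diff_distrib distrib_right mult.assoc)
    also have "\<dots> = 0"
    proof -
      consider "l = p" | "l = q" | "l \<noteq> p" "l \<noteq> q" by blast
      then show ?thesis
      proof cases
        case 1
        with a orth[of q p] pq show ?thesis by simp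
      next
        case 2
        with b orth[of p q] pq show ?thesis by simp
      next
        case 3
        with h_orth[OF l] orth[of p l] orth[of q l] pq l show ?thesis by simp
      qed
    qed
    finally have "cnj (\<integral>x. g x * cnj (e l x) \<partial>M) = 0"
      by simp
    then have "(\<integral>x. cnj (g x * cnj (e l x)) \<partial>M) = 0"
      by (simp only: Bochner_Integration.integral_cnj)
    then show ?thesis
      by (simp add: mult.commute)
  qed
  ultimately have "AE x in M. g x = 0"
    by (intro total g)
  then show ?thesis
    by eventually_elim (simp add: g_def)
qed

text \<open>
  The centred indicator of a set of measure strictly between \<open>0\<close> and \<open>1\<close>.
\<close>

lemma non_atomic_imp_nonconstant:
  assumes M: "prob_space M" and na: "non_atomic M"
  obtains g where "g \<in> L2 M" "(\<integral>x. g x \<partial>M) = 0" "\<not> (AE x in M. g x = 0)"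
proof -
  interpret prob_space M by fact
  have "0 < emeasure M (space M)"
    by (simp add: emeasure_space_1)
  with na have "\<exists>B\<in>sets M. B \<subseteq> space M \<and> 0 < emeasure M B \<and> emeasure M B < emeasure M (space M)"
    unfolding non_atomic_def by blast
  then obtain B where B[measurable]: "B \<in> sets M"
    and pos: "0 < emeasure M B" and less: "emeasure M B < 1"
    using emeasure_space_1 by auto
  define g :: "'a \<Rightarrow> complex" where "g x = of_real (indicator B x - prob B)" for x
  have "g \<in> borel_measurable M"
    unfolding g_def by measurable
  moreover have "integrable M (\<lambda>x. (cmod (g x))\<^sup>2)"
  proof (rule integrable_const_bound[where B = 1])
    have "(cmod (g x))\<^sup>2 \<le> 1" for x
      unfolding g_def norm_of_real
      by (intro power_le_one) (auto simp: indicator_def split: if_splits)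
    then show "AE x in M. norm ((cmod (g x))\<^sup>2) \<le> 1" by simp
  qed (simp add: g_def)
  ultimately have "g \<in> L2 M"
    by (simp add: L2_def)
  moreover have "(\<integral>x. g x \<partial>M) = 0"
    unfolding g_def integral_complex_of_real
    by (subst Bochner_Integration.integral_diff)
      (auto simp: prob_space less_top[symmetric] intro!: integrable_real_indicator)
  moreover have "\<not> (AE x in M. g x = 0)"
  proof
    assume "AE x in M. g x = 0"
    then have AE: "AE x in M. indicator B x = prob B"
      by eventually_elim (auto simp: g_def)
    show False
    proof (cases "prob B = 0")
      case True
      with pos show False by (simp add: emeasure_eq_measure)
    next
      case False
      from AE have "AE x in M. x \<in> B"
        by eventually_elim (use False in \<open>auto simp: indicator_def of_bool_def split: if_splits\<close>)
      then have "prob B = 1"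
        by (simp add: prob_eq_1)
      with less show False by (simp add: emeasure_eq_measure)
    qed
  qed
  ultimately show thesis by (rule that)
qed

section \<open>Non-existence of the family\<close>

text \<open>
  If the conjugate of \<open>f\<close> is \<open>k \<sqdot> f\<close>, then \<open>f\<close> is real up to a constant phase. Conjugating the integrals
  that define the two coefficients multiplies both of them by the same factor \<open>k\<close>, so their ratio is
  unchanged. The equation in the conclusion expresses this without division.
\<close>

lemma ratio_real_if_cnj_proportional:
  assumes S: "measure_preserving M S" and f: "f \<in> L2 M" and norm: "(\<integral>x. f x * cnj (f x) \<partial>M) = N"
    and nonzero: "\<not> (AE x in M. f x = 0)"
    and cnj: "AE x in M. cnj (f x) = k * f x"
    and a: "(\<integral>x. f x * f (S x) * cnj (f x) \<partial>M) = a * N"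
    and b: "(\<integral>x. f x * f (S x) * cnj (f (S x)) \<partial>M) = b * N"
  shows "b * cnj a = cnj b * a"
proof -
  note [measurable] = L2D(1)[OF f] measure_preservingD(1)[OF S]
  have "N \<noteq> 0"
    using AE_zero_if_inner_self_zero[OF f] norm nonzero by auto
  have "cnj N = N"
    using Bochner_Integration.integral_cnj[of M "\<lambda>x. f x * cnj (f x)"] norm by (simp add: mult.commute)
  have cnj': "AE x in M. cnj (f (S x)) = k * f (S x)"
    by (rule AE_compose_measure_preserving[OF S cnj])
  have "(\<integral>x. cnj (f x * f (S x) * cnj (f x)) \<partial>M) = (\<integral>x. k * (f x * f (S x) * cnj (f x)) \<partial>M)"
    by (rule integral_cong_AE, measurable) (use cnj' in \<open>eventually_elim, simp\<close>)
  then have "cnj (a * N) = k * (a * N)"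
    unfolding Bochner_Integration.integral_cnj a by (simp add: a)
  then have a': "cnj a = k * a"
    using \<open>N \<noteq> 0\<close> \<open>cnj N = N\<close> by simp
  have "(\<integral>x. cnj (f x * f (S x) * cnj (f (S x))) \<partial>M)
      = (\<integral>x. k * (f x * f (S x) * cnj (f (S x))) \<partial>M)"
    by (rule integral_cong_AE, measurable) (use cnj in \<open>eventually_elim, simp\<close>)
  then have "cnj (b * N) = k * (b * N)"
    unfolding Bochner_Integration.integral_cnj b by (simp add: b)
  then have "cnj b = k * b"
    using \<open>N \<noteq> 0\<close> \<open>cnj N = N\<close> by simp
  with a' show ?thesis
    by simp
qed

theorem theorem1p5:
  fixes M :: "'a measure" and c :: complex
  assumes "prob_space M" and "standard_borel_space M" and "non_atomic M"
    and "c \<noteq> 0"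
  shows "\<not> (\<exists>T. transformation M T \<and>
    (\<exists>(I :: nat set) (f :: nat \<Rightarrow> 'a \<Rightarrow> complex).
       I \<subseteq> {1..} \<and>
       (\<forall>i\<in>I. three_fold_Lebesgue M T (f i)) \<and>
       L2_zero_mean M = cyclic_subspace M T (f ` I) \<and>
       (\<forall>p\<in>B_labels I. \<forall>q\<in>B_labels I. \<forall>r\<in>B_labels I.
          p \<noteq> q \<and> p \<noteq> r \<and> q \<noteq> r \<longrightarrow>
          has_bochner_integral M
            (\<lambda>x. B_family M T f c p x * B_family M T f c q x * cnj (B_family M T f c r x)) 0)))"
proof (intro notI, elim exE conjE)
  fix T and I :: "nat set" and f :: "nat \<Rightarrow> 'a \<Rightarrow> complex"
  assume T: "transformation M T"
    and leb: "\<forall>i\<in>I. three_fold_Lebesgue M T (f i)"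
    and gen: "L2_zero_mean M = cyclic_subspace M T (f ` I)"
    and triple: "\<forall>p\<in>B_labels I. \<forall>q\<in>B_labels I. \<forall>r\<in>B_labels I.
          p \<noteq> q \<and> p \<noteq> r \<and> q \<noteq> r \<longrightarrow>
          has_bochner_integral M
            (\<lambda>x. B_family M T f c p x * B_family M T f c q x * cnj (B_family M T f c r x)) 0"
  note M = \<open>prob_space M\<close>
  define E where "E = I \<times> (UNIV :: int set)"
  define e where "e l = koopman_power M T (snd l) (f (fst l))" for l
  have labels: "None \<in> B_labels I" "\<And>l. l \<in> E \<Longrightarrow> Some l \<in> B_labels I"
    by (auto simp: B_labels_def E_def)
  have family: "B_family M T f c None = (\<lambda>_. c)" "\<And>l. B_family M T f c (Some l) = e l"
    by (auto simp: B_family_def e_def split: prod.split)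
  have f_zero_mean: "f i \<in> L2_zero_mean M" if "i \<in> I" for i
    using that by (auto simp: gen cyclic_subspace_def)
  have e: "e l \<in> L2 M" and mean: "(\<integral>x. e l x \<partial>M) = 0" if "l \<in> E" for l
  proof -
    from that have "f (fst l) \<in> L2 M" and "(\<integral>x. f (fst l) x \<partial>M) = 0"
      using f_zero_mean by (auto simp: E_def L2_zero_mean_def)
    then show "e l \<in> L2 M" and "(\<integral>x. e l x \<partial>M) = 0"
      unfolding e_def koopman_power_eq_compose
      by (simp_all add: L2_compose L2D(1) integral_compose_measure_preserving
          measure_preserving_orbit_map[OF T])
  qed
  have orth: "(\<integral>x. e l x * cnj (e m x) \<partial>M) = 0" if "l \<in> E" "m \<in> E" "l \<noteq> m" for l m
  proof -
    have "has_bochner_integral M (\<lambda>x. e l x * c * cnj (e m x)) 0"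
      using triple[rule_format, OF labels(2)[OF that(1)] labels(1) labels(2)[OF that(2)]] that(3)
      by (simp add: family)
    then have "(\<integral>x. c * (e l x * cnj (e m x)) \<partial>M) = 0"
      by (simp add: has_bochner_integral_iff ac_simps)
    with \<open>c \<noteq> 0\<close> show ?thesis by simp
  qed
  have prod_mean: "(\<integral>x. e l x * e m x \<partial>M) = 0" if "l \<in> E" "m \<in> E" "l \<noteq> m" for l m
  proof -
    have "has_bochner_integral M (\<lambda>x. e l x * e m x * cnj c) 0"
      using triple[rule_format, OF labels(2)[OF that(1)] labels(2)[OF that(2)] labels(1)] that(3)
      by (simp add: family)
    with \<open>c \<noteq> 0\<close> show ?thesis
      by (simp add: has_bochner_integral_iff)
  qed
  have prod_orth: "(\<integral>x. e l x * e m x * cnj (e k x) \<partial>M) = 0"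
    if "l \<in> E" "m \<in> E" "k \<in> E" "l \<noteq> m" "l \<noteq> k" "m \<noteq> k" for l m k
    using triple[rule_format, OF labels(2)[OF that(1)] labels(2)[OF that(2)] labels(2)[OF that(3)]]
      that by (simp add: family has_bochner_integral_iff)
  have total: "AE x in M. g x = 0"
    if "g \<in> L2 M" "(\<integral>x. g x \<partial>M) = 0" "\<And>l. l \<in> E \<Longrightarrow> (\<integral>x. e l x * cnj (g x) \<partial>M) = 0" for g
  proof (rule generators_total[OF T gen that(1,2)])
    fix h n
    assume "h \<in> f ` I"
    then obtain i where "i \<in> I" "h = f i" by auto
    then show "(\<integral>x. koopman_power M T n h x * cnj (g x) \<partial>M) = 0"
      using that(3)[of "(i, n)"] by (simp add: E_def e_def)
  qed
  have "I \<noteq> {}"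
  proof
    assume "I = {}"
    then have "E = {}" by (simp add: E_def)
    moreover obtain g where "g \<in> L2 M" "(\<integral>x. g x \<partial>M) = 0" "\<not> (AE x in M. g x = 0)"
      using non_atomic_imp_nonconstant[OF M \<open>non_atomic M\<close>] by blast
    ultimately show False using total by blast
  qed
  then obtain i where i: "i \<in> I" by blast
  \<comment> \<open>The Lebesgue property controls \<open>T\<^sup>m f \<sqdot> T\<^sup>n f\<close> for non-zero exponents, hence the base point \<open>T f\<close> instead of \<open>f\<close>.\<close>
  define \<phi> where "\<phi> = e (i, 1)"
  have T_mp: "measure_preserving M T"
    by (rule transformation_measure_preserving(1)[OF T])
  have e_Suc: "e (i, 1 + int n) = (\<lambda>x. \<phi> ((T ^^ n) x))" for n
    by (simp add: e_def \<phi>_def koopman_power_eq_compose orbit_map_def nat_add_distrib)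
  have i_E: "(i, n) \<in> E" for n
    using i by (simp add: E_def)
  have \<phi>: "\<phi> \<in> L2 M" "(\<integral>x. \<phi> x \<partial>M) = 0"
    unfolding \<phi>_def by (rule e[OF i_E], rule mean[OF i_E])
  note [measurable] = L2D(1)[OF \<phi>(1)]
  have "f i \<in> L2 M" and f_nonzero: "\<not> (AE x in M. f i x = 0)"
    using leb i by (auto simp: three_fold_Lebesgue_def)
  have \<phi>_nonzero: "\<not> (AE x in M. \<phi> x = 0)"
  proof
    assume "AE x in M. \<phi> x = 0"
    then have "AE x in M. \<phi> (the_inv_into (space M) T x) = 0"
      by (rule AE_compose_measure_preserving[OF transformation_measure_preserving(2)[OF T]])
    moreover have "AE x in M. \<phi> (the_inv_into (space M) T x) = f i x"
    proof (rule AE_I2)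
      fix x assume "x \<in> space M"
      then show "\<phi> (the_inv_into (space M) T x) = f i x"
        using T by (simp add: \<phi>_def e_def koopman_power_eq_compose orbit_map_def
            transformation_def bij_betw_def f_the_inv_into_f)
    qed
    ultimately have "AE x in M. f i x = 0"
      by eventually_elim simp
    with f_nonzero show False ..
  qed
  have no_return: "AE x in M. \<phi> x * \<phi> ((T ^^ n) x) = 0" if n: "1 \<le> n" for n
  proof -
    define S where "S = T ^^ n"
    have S: "measure_preserving M S"
      unfolding S_def by (rule measure_preserving_funpow[OF T_mp])
    define p where "p = (i, 1 :: int)"
    define q where "q = (i, 1 + int n)"
    have pq: "p \<in> E" "q \<in> E" "p \<noteq> q"
      using n by (auto simp: p_def q_def i_E)
    have ep: "e p = \<phi>" and eq: "e q = (\<lambda>x. \<phi> (S x))"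
      by (simp_all add: p_def q_def \<phi>_def[symmetric] e_Suc S_def)
    have SS: "e (i, 1 + int (2 * n)) = (\<lambda>x. \<phi> (S (S x)))"
      by (simp only: e_Suc S_def mult_2 funpow_add comp_def)
    define N where "N = (\<integral>x. \<phi> x * cnj (\<phi> x) \<partial>M)"
    have Np: "(\<integral>x. e p x * cnj (e p x) \<partial>M) = N"
      by (simp add: ep N_def)
    have Nq: "(\<integral>x. e q x * cnj (e q x) \<partial>M) = N"
      using integral_compose_measure_preserving[OF S, of "\<lambda>x. \<phi> x * cnj (\<phi> x)"]
      by (simp add: eq N_def)
    have "N \<noteq> 0"
      using AE_zero_if_inner_self_zero[OF \<phi>(1)] \<phi>_nonzero by (auto simp: N_def)
    define k where "k = (\<integral>x. cnj (e p x) * cnj (e p x) \<partial>M) / N"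
    have cnj_orth: "(\<integral>x. cnj (e p x) * cnj (e l x) \<partial>M) = 0" if "l \<in> E" "l \<noteq> p" for l
      using Bochner_Integration.integral_cnj[of M "\<lambda>x. e p x * e l x"] prod_mean[of p l] pq that by simp
    \<comment> \<open>The conjugate of \<open>e p\<close> has no component along \<open>e q\<close>, hence the coefficient \<open>0\<close>.\<close>
    have "AE x in M. cnj (e p x) = k * e p x + 0 * e q x"
    proof (rule two_term_expansion[OF e M mean orth total pq])
      show "(\<integral>x. cnj (e p x) * cnj (e p x) \<partial>M) = k * (\<integral>x. e p x * cnj (e p x) \<partial>M)"
        using \<open>N \<noteq> 0\<close> by (simp add: k_def Np)
      show "(\<integral>x. cnj (e p x) \<partial>M) = 0"
        using mean[OF pq(1)] by (simp add: Bochner_Integration.integral_cnj)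
      show "(\<lambda>x. cnj (e p x)) \<in> L2 M"
        by (rule L2_cnj[OF e[OF pq(1)]])
    qed (use cnj_orth pq in auto)
    then have cnj: "AE x in M. cnj (\<phi> x) = k * \<phi> x"
      by (simp add: ep)
    define a where "a = (\<integral>x. e p x * e q x * cnj (e p x) \<partial>M) / N"
    define b where "b = (\<integral>x. e p x * e q x * cnj (e q x) \<partial>M) / N"
    have "AE x in M. e p x * e q x = a * e p x + b * e q x"
    proof (rule two_term_expansion[OF e M mean orth total pq])
      show "(\<integral>x. e p x * e q x * cnj (e p x) \<partial>M) = a * (\<integral>x. e p x * cnj (e p x) \<partial>M)"
        and "(\<integral>x. e p x * e q x * cnj (e q x) \<partial>M) = b * (\<integral>x. e q x * cnj (e q x) \<partial>M)"
        using \<open>N \<noteq> 0\<close> by (simp_all add: a_def b_def Np Nq)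
      have "koopman_power M T 1 (f i) = e p" "koopman_power M T (1 + int n) (f i) = e q"
        by (simp_all add: p_def q_def e_def)
      moreover have "(\<lambda>x. koopman_power M T 1 (f i) x * koopman_power M T (1 + int n) (f i) x) \<in> L2 M"
        using leb[rule_format, OF i] n unfolding three_fold_Lebesgue_def by simp
      ultimately show "(\<lambda>x. e p x * e q x) \<in> L2 M"
        by simp
    qed (use prod_mean[OF pq] prod_orth[OF pq(1,2)] pq(3) in auto)
    then have expansion: "AE x in M. \<phi> x * \<phi> (S x) = a * \<phi> x + b * \<phi> (S x)"
      by (simp add: ep eq)
    have real: "b * cnj a = cnj b * a"
      by (rule ratio_real_if_cnj_proportional[OF S \<phi>(1) N_def[symmetric] \<phi>_nonzero cnj])
        (use \<open>N \<noteq> 0\<close> in \<open>simp_all add: a_def b_def ep eq\<close>)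
    have "(\<integral>x. \<phi> (S (S x)) * cnj (\<phi> x) \<partial>M) = 0"
      using orth[OF i_E i_E, of "1 + int (2 * n)" 1] n unfolding SS \<phi>_def[symmetric] by simp
    from product_with_translate_not_in_span[OF M S \<phi> this real expansion]
    show ?thesis
      by (simp add: S_def)
  qed
  have "AE x in M. \<phi> x \<noteq> 0 \<longrightarrow> (\<exists>n\<ge>1. \<phi> ((T ^^ n) x) \<noteq> 0)"
    by (rule AE_recurrence[OF M T_mp]) measurable
  moreover have "AE x in M. \<forall>n. 1 \<le> n \<longrightarrow> \<phi> x * \<phi> ((T ^^ n) x) = 0"
    using no_return by (auto simp: AE_all_countable)
  ultimately have "AE x in M. \<phi> x = 0"
    by eventually_elim auto
  with \<phi>_nonzero show False ..
qed

end
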